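(* Let $G$ be a graph of order $n$ with $\chi(G)\geq 3$, and let $H$ be any graph of order $m\leq \chi(G)-2$. Then $$nm \;\leq\; sn(G\circ H)\;\leq\; nm+sn(G).$$
   Context: All graphs are finite, undirected, simple and connected; the order of a graph is its number of vertices. $\chi(G)$ is the chromatic number. Sudoku number: let $\chi(G)=k$ and fix the set of $k$ colors $\{1,\dots,k\}$. For $S\subset V(G)$ let $C_0$ be a proper coloring of the induced subgraph $G[S]$ with colors from these $k$ colors (at most $k$ colors are used). $C_0$ is called extendable if it can be extended to a proper coloring of $G$ with these $k$ colors, and it is a Sudoku coloring of $G$ if this extension exists and is unique. The Sudoku number $sn(G)$ is the smallest $|S|$ such that $G[S]$ admits a Sudoku coloring. Corona product: $G\circ H$ is obtained from one copy of $G$ and $|V(G)|$ disjoint copies of $H$ by joining the $i$-th vertex of $G$ to every vertex of the $i$-th copy of $H$. *)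

theory Defs
  imports "Graph_Theory.Graph_Theory" "HOL-Library.FuncSet"
begin

text \<open>
  Finite simple graphs are the symmetric loop-free digraphs given by
  \<^locale>\<open>pair_graph\<close>. The library's \<^const>\<open>connected\<close> requires at least one vertex.

  A coloring of \<open>G\<close> is a function on \<open>verts G\<close> only (it is \<^const>\<open>undefined\<close> elsewhere), so that
  equality of colorings, and hence uniqueness of an extension, has its usual meaning.
\<close>

definition proper_colorings :: "('a, 'b) pre_digraph \<Rightarrow> nat \<Rightarrow> ('a \<Rightarrow> nat) set" where
  "proper_colorings G k =
     {c \<in> verts G \<rightarrow>\<^sub>E {1..k}. \<forall>u v. u \<rightarrow>\<^bsub>G\<^esub> v \<longrightarrow> c u \<noteq> c v}"

definition chromatic_number :: "('a, 'b) pre_digraph \<Rightarrow> nat" where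
  "chromatic_number G = (LEAST k. proper_colorings G k \<noteq> {})"

definition extends_coloring :: "'a set \<Rightarrow> ('a \<Rightarrow> nat) \<Rightarrow> ('a \<Rightarrow> nat) \<Rightarrow> bool" where
  "extends_coloring S C\<^sub>0 c \<longleftrightarrow> restrict c S = C\<^sub>0"

definition sudoku_coloring :: "('a, 'b) pre_digraph \<Rightarrow> 'a set \<Rightarrow> ('a \<Rightarrow> nat) \<Rightarrow> bool" where
  "sudoku_coloring G S C\<^sub>0 \<longleftrightarrow>
     C\<^sub>0 \<in> proper_colorings (G \<restriction> S) (chromatic_number G) \<and>
     (\<exists>!c. c \<in> proper_colorings G (chromatic_number G) \<and> extends_coloring S C\<^sub>0 c)"

definition sudoku_number :: "('a, 'b) pre_digraph \<Rightarrow> nat" where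
  "sudoku_number G = (LEAST s. \<exists>S \<subseteq> verts G. card S = s \<and> (\<exists>C\<^sub>0. sudoku_coloring G S C\<^sub>0))"

text \<open>
  In the corona, \<open>Inl v\<close> is the vertex \<open>v\<close> of \<open>G\<close> and \<open>Inr (v, x)\<close> is the vertex \<open>x\<close> in the
  copy of \<open>H\<close> attached to \<open>v\<close>. Every edge is listed in both directions.
\<close>

definition corona ::
    "'a pair_pre_digraph \<Rightarrow> 'b pair_pre_digraph \<Rightarrow> ('a + 'a \<times> 'b) pair_pre_digraph" where
  "corona G H =
     \<lparr> pverts = Inl ` pverts G \<union> Inr ` (pverts G \<times> pverts H),
       parcs =
         {(Inl u, Inl v) | u v. (u, v) \<in> parcs G} \<union>
         {(Inr (v, x), Inr (v, y)) | v x y. v \<in> pverts G \<and> (x, y) \<in> parcs H} \<union>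
         {(Inl v, Inr (v, x)) | v x. v \<in> pverts G \<and> x \<in> pverts H} \<union>
         {(Inr (v, x), Inl v) | v x. v \<in> pverts G \<and> x \<in> pverts H} \<rparr>"

lemma parcs_coronaE:
  assumes "e \<in> parcs (corona G H)"
  obtains u v where "e = (Inl u, Inl v)" "(u, v) \<in> parcs G"
  | v x y where "e = (Inr (v, x), Inr (v, y))" "v \<in> pverts G" "(x, y) \<in> parcs H"
  | v x where "e = (Inl v, Inr (v, x))" "v \<in> pverts G" "x \<in> pverts H"
  | v x where "e = (Inr (v, x), Inl v)" "v \<in> pverts G" "x \<in> pverts H"
  using assms by (auto simp: corona_def)

lemma pair_graph_corona:
  assumes "pair_graph G" and "pair_graph H"
  shows "pair_graph (corona G H)"
proof -
  interpret G: pair_graph G by (fact assms(1))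
  interpret H: pair_graph H by (fact assms(2))
  have wf: "fst e \<in> pverts (corona G H) \<and> snd e \<in> pverts (corona G H) \<and> fst e \<noteq> snd e"
    if "e \<in> parcs (corona G H)" for e
    using that G.in_arcsD1 G.in_arcsD2 H.in_arcsD1 H.in_arcsD2
    by (elim parcs_coronaE) (auto simp: corona_def dest: G.pair_no_loops H.pair_no_loops)
  have fin: "finite (pverts (corona G H))"
    by (simp add: corona_def G.pair_finite_verts H.pair_finite_verts)
  have "parcs (corona G H) \<subseteq> pverts (corona G H) \<times> pverts (corona G H)"
    using wf by (auto simp: mem_Times_iff)
  then have fin_arcs: "finite (parcs (corona G H))"
    using fin by (meson finite_SigmaI finite_subset)
  have sym: "sym (parcs G)" "sym (parcs H)"
    using G.pair_sym_arcs H.pair_sym_arcs by (simp_all add: symmetric_def)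
  have "(b, a) \<in> parcs (corona G H)" if "(a, b) \<in> parcs (corona G H)" for a b
    using that symD[OF sym(1)] symD[OF sym(2)]
    by (elim parcs_coronaE) (auto simp: corona_def)
  then have "sym (parcs (corona G H))"
    by (rule symI)
  then have "symmetric (corona G H)"
    by (simp add: symmetric_def)
  then show ?thesis
    using wf fin fin_arcs by unfold_locales auto
qed

end

theory Submission
  imports Defs
begin

text \<open>
  A vertex of degree at most \<open>\<chi> - 2\<close> that is left uncolored can always be recolored, so it lies in
  the domain of every Sudoku coloring. In the corona every vertex of a copy of \<open>H\<close> has degree at most
  \<open>m \<le> \<chi> - 2\<close>, which gives the lower bound. Conversely, a Sudoku coloring of \<open>G\<close> together with
  a suitable coloring of all copies of \<open>H\<close> is a Sudoku coloring of the corona.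
\<close>

section \<open>Proper colorings and the chromatic number\<close>

lemma arcs_ends_induce_subgraph:
  "(u, v) \<in> arcs_ends (G \<restriction> S) \<longleftrightarrow> (u, v) \<in> arcs_ends G \<and> u \<in> S \<and> v \<in> S"
  by (auto simp: arcs_ends_def arc_to_ends_def)

lemma restrict_in_proper_colorings:
  assumes "c \<in> proper_colorings G k" and "S \<subseteq> verts G"
  shows "restrict c S \<in> proper_colorings (G \<restriction> S) k"
  using assms by (auto simp: proper_colorings_def arcs_ends_induce_subgraph)

lemma proper_colorings_chromatic_number:
  "c \<in> proper_colorings G k \<Longrightarrow> proper_colorings G (chromatic_number G) \<noteq> {}"
  unfolding chromatic_number_def by (rule LeastI[of _ k]) auto

lemma chromatic_number_le: "c \<in> proper_colorings G k \<Longrightarrow> chromatic_number G \<le> k"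
  unfolding chromatic_number_def by (rule Least_le) auto

lemma (in pair_graph) arc_endsD:
  assumes "(u, v) \<in> parcs G"
  shows "u \<in> pverts G" "v \<in> pverts G" "u \<noteq> v"
  using assms in_arcsD1 in_arcsD2 pair_no_loops[OF assms] by auto

text \<open>Giving every vertex its own color is proper because there are no loops, so the
  \<open>LEAST\<close> in \<open>chromatic_number\<close> ranges over a nonempty set and is
  attained.\<close>

lemma (in pair_graph) ex_chromatic_coloring:
  obtains c where "c \<in> proper_colorings G (chromatic_number G)"
proof -
  obtain h where h: "bij_betw h (pverts G) {1..card (pverts G)}"
    using finite_same_card_bij[OF pair_finite_verts, of "{1..card (pverts G)}"] by auto
  have "h u \<noteq> h v" if "(u, v) \<in> parcs G" for u v
    using arc_endsD[OF that] h by (metis bij_betw_imp_inj_on inj_onD)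
  moreover have "h u \<in> {1..card (pverts G)}" if "u \<in> pverts G" for u
    using h that by (rule bij_betwE[rule_format])
  ultimately have "restrict h (pverts G) \<in> proper_colorings G (card (pverts G))"
    by (auto simp: proper_colorings_def dest: arc_endsD)
  then show ?thesis
    using proper_colorings_chromatic_number that by blast
qed

section \<open>Sudoku colorings of a single graph\<close>

lemma sudoku_coloringE:
  assumes "sudoku_coloring G S C\<^sub>0"
  obtains c where "c \<in> proper_colorings G (chromatic_number G)" "restrict c S = C\<^sub>0"
    and "\<And>d. d \<in> proper_colorings G (chromatic_number G) \<Longrightarrow> restrict d S = C\<^sub>0 \<Longrightarrow> d = c"
  using assms unfolding sudoku_coloring_def extends_coloring_def by blast

lemma sudoku_number_le:
  "S \<subseteq> verts G \<Longrightarrow> sudoku_coloring G S C\<^sub>0 \<Longrightarrow> sudoku_number G \<le> card S"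
  unfolding sudoku_number_def by (rule Least_le) blast

text \<open>An optimal coloring prescribed on all vertices extends only to itself, so Sudoku domains
  exist and the \<open>LEAST\<close> in \<open>sudoku_number\<close> is attained.\<close>

lemma (in pair_graph) ex_minimum_sudoku_coloring:
  obtains S C\<^sub>0 where "S \<subseteq> pverts G" "card S = sudoku_number G" "sudoku_coloring G S C\<^sub>0"
proof -
  obtain c where c: "c \<in> proper_colorings G (chromatic_number G)"
    by (rule ex_chromatic_coloring)
  have "restrict d (verts G) = d" if "d \<in> proper_colorings G (chromatic_number G)" for d
    using that by (auto simp: proper_colorings_def PiE_restrict)
  then have "sudoku_coloring G (verts G) c"
    using c restrict_in_proper_colorings[OF c order_refl]
    by (auto simp: sudoku_coloring_def extends_coloring_def)
  then have "\<exists>S \<subseteq> verts G. card S = card (verts G) \<and> (\<exists>C\<^sub>0. sudoku_coloring G S C\<^sub>0)"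
    by blast
  from LeastI[of "\<lambda>s. \<exists>S \<subseteq> verts G. card S = s \<and> (\<exists>C\<^sub>0. sudoku_coloring G S C\<^sub>0)", OF this]
  show ?thesis
    using that unfolding sudoku_number_def[symmetric] by auto
qed

text \<open>If \<open>v\<close> were outside \<open>S\<close>, some color would differ from its
  present one and from those of its neighbors; recoloring \<open>v\<close> with it would give a
  second extension.\<close>

lemma (in pair_graph) low_degree_vertex_in_sudoku_domain:
  assumes sudoku: "sudoku_coloring G S C\<^sub>0" and v: "v \<in> pverts G"
    and deg: "card {u. (v, u) \<in> parcs G} + 2 \<le> chromatic_number G"
  shows "v \<in> S"
proof (rule ccontr)
  assume "v \<notin> S"
  let ?k = "chromatic_number G" and ?N = "{u. (v, u) \<in> parcs G}"
  obtain c where c: "c \<in> proper_colorings G ?k" "restrict c S = C\<^sub>0"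
    and unique: "\<And>d. d \<in> proper_colorings G ?k \<Longrightarrow> restrict d S = C\<^sub>0 \<Longrightarrow> d = c"
    by (rule sudoku_coloringE[OF sudoku]) blast
  have "?N \<subseteq> pverts G"
    using arc_endsD by blast
  then have fin: "finite ?N"
    using pair_finite_verts by (rule finite_subset)
  \<comment> \<open>The neighbors block at most \<chi> - 2 colors and \<open>c v\<close> one more,
    so at least one color is left. This is the source of the 2 in the degree bound.\<close>
  have "card (insert (c v) (c ` ?N)) < card {1..?k}"
    using deg card_image_le[OF fin, of c] card_insert_le_m1[of "Suc (card ?N)" "c ` ?N" "c v"] by simp
  then have "\<not> {1..?k} \<subseteq> insert (c v) (c ` ?N)"
    using fin card_mono[of "insert (c v) (c ` ?N)" "{1..?k}"] by auto
  then obtain j where j: "j \<in> {1..?k}" "j \<noteq> c v" "j \<notin> c ` ?N"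
    by blast
  \<comment> \<open>\<open>?N\<close> records only arcs leaving \<open>v\<close>; symmetry covers
    those entering it.\<close>
  have sym: "(v, u) \<in> parcs G" if "(u, v) \<in> parcs G" for u
    using pair_sym_arcs that by (simp add: symmetric_def symD)
  have "c(v := j) \<in> proper_colorings G ?k"
    using c(1) j v sym
    by (auto simp: proper_colorings_def PiE_iff extensional_def dest: arc_endsD)
  moreover have "restrict (c(v := j)) S = C\<^sub>0"
    using \<open>v \<notin> S\<close> unfolding c(2)[symmetric] by (auto simp: restrict_def)
  ultimately have "c(v := j) = c"
    by (rule unique)
  then show False
    using j(2) by (metis fun_upd_same)
qed

section \<open>Colorings and Sudoku colorings of the corona\<close>

lemma corona_coloring_base:
  assumes "d \<in> proper_colorings (corona G H) k" and "pair_graph G"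
  shows "(\<lambda>v\<in>pverts G. d (Inl v)) \<in> proper_colorings (with_proj G) k"
proof -
  interpret pair_graph G by (fact assms(2))
  show ?thesis
    using assms(1) by (auto simp: proper_colorings_def corona_def PiE_iff dest: arc_endsD)
qed

text \<open>Each copy of \<open>H\<close> is colored injectively, hence properly whatever its arcs
  are, avoiding the color of the vertex of \<open>G\<close> to which it is attached.\<close>

lemma extend_coloring_to_corona:
  assumes "pair_graph G" and "pair_graph H"
    and c: "c \<in> proper_colorings (with_proj G) k" and card: "card (pverts H) < k"
  obtains d where "d \<in> proper_colorings (corona G H) k" "\<And>v. v \<in> pverts G \<Longrightarrow> d (Inl v) = c v"
proof -
  interpret G: pair_graph G by (fact assms(1))
  interpret H: pair_graph H by (fact assms(2))
  \<comment> \<open>Removing one element leaves at least \<open>k - 1\<close> colors whether or not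
    \<open>c v\<close> lies in the palette. The claim thus holds for every \<open>v\<close>, and
    \<open>f\<close> can be chosen without a membership condition.\<close>
  have "\<exists>f. f ` pverts H \<subseteq> {1..k} - {c v} \<and> inj_on f (pverts H)" for v
    using card diff_card_le_card_Diff[of "{c v}" "{1..k}"]
    by (intro card_le_inj) auto
  then obtain f where f: "\<And>v. f v ` pverts H \<subseteq> {1..k} - {c v}" "\<And>v. inj_on (f v) (pverts H)"
    by metis
  have fH: "f v x \<in> {1..k} \<and> f v x \<noteq> c v" if "x \<in> pverts H" for v x
    using f(1)[of v] that by auto
  have adj: "f v x \<noteq> f v y" if "(x, y) \<in> parcs H" for v x y
    using H.arc_endsD[OF that] f(2)[of v] by (metis inj_onD)
  define d where "d = (\<lambda>z\<in>pverts (corona G H). case z of Inl v \<Rightarrow> c v | Inr (v, x) \<Rightarrow> f v x)"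
  have d_Inl: "d (Inl v) = c v" if "v \<in> pverts G" for v
    using that by (auto simp: d_def corona_def)
  have d_Inr: "d (Inr (v, x)) = f v x" if "v \<in> pverts G" "x \<in> pverts H" for v x
    using that by (auto simp: d_def corona_def)
  have "d z \<in> {1..k}" if "z \<in> pverts (corona G H)" for z
    using that c fH by (auto simp: d_def corona_def proper_colorings_def PiE_iff)
  then have "d \<in> pverts (corona G H) \<rightarrow>\<^sub>E {1..k}"
    by (auto simp: d_def)
  moreover have "d a \<noteq> d b" if "(a, b) \<in> parcs (corona G H)" for a b
    using that
  proof (cases rule: parcs_coronaE)
    case (1 u v)
    then have "u \<in> pverts G" "v \<in> pverts G"
      using G.arc_endsD by blast+
    then show ?thesis
      using 1 c d_Inl by (auto simp: proper_colorings_def)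
  next
    case (2 v x y)
    then have "x \<in> pverts H" "y \<in> pverts H"
      using H.arc_endsD by blast+
    then show ?thesis
      using 2 adj d_Inr by simp
  next
    case (3 v x)
    then show ?thesis
      using fH[of x v] d_Inl d_Inr by auto
  next
    case (4 v x)
    then show ?thesis
      using fH[of x v] d_Inl d_Inr by auto
  qed
  ultimately have "d \<in> proper_colorings (corona G H) k"
    by (auto simp: proper_colorings_def)
  then show ?thesis
    using d_Inl by (rule that)
qed

text \<open>Optimal colorings of \<open>G\<close> extend to the corona, and those of the corona
  restrict to \<open>G\<close>. Sudoku colorings of both graphs therefore use the same
  palette.\<close>

lemma chromatic_number_corona:
  assumes "pair_graph G" and "pair_graph H" and "card (pverts H) < chromatic_number G"
  shows "chromatic_number (corona G H) = chromatic_number G"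
proof (rule antisym)
  obtain c where "c \<in> proper_colorings G (chromatic_number G)"
    using pair_graph.ex_chromatic_coloring[OF assms(1)] .
  then show "chromatic_number (corona G H) \<le> chromatic_number G"
    using extend_coloring_to_corona[OF assms(1,2)] assms(3) chromatic_number_le by metis
next
  obtain d where "d \<in> proper_colorings (corona G H) (chromatic_number (corona G H))"
    using pair_graph.ex_chromatic_coloring[OF pair_graph_corona[OF assms(1,2)]] .
  then show "chromatic_number G \<le> chromatic_number (corona G H)"
    using corona_coloring_base[OF _ assms(1)] chromatic_number_le by blast
qed

text \<open>The neighbors are the attached vertex of \<open>G\<close> and some vertices of the copy
  other than \<open>x\<close> itself; excluding \<open>x\<close> keeps the bound at \<open>m\<close>
  rather than \<open>m + 1\<close>.\<close>

lemma card_neighbors_copy: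
  assumes "pair_graph H" and "x \<in> pverts H"
  shows "card {z. (Inr (v, x), z) \<in> parcs (corona G H)} \<le> card (pverts H)"
proof -
  interpret pair_graph H by (fact assms(1))
  let ?B = "insert (Inl v) ((\<lambda>y. Inr (v, y)) ` (pverts H - {x})) :: ('b + 'b \<times> 'a) set"
  have "{z. (Inr (v, x), z) \<in> parcs (corona G H)} \<subseteq> ?B"
    by (auto simp: corona_def image_iff dest: arc_endsD)
  then have "card {z. (Inr (v, x), z) \<in> parcs (corona G H)} \<le> card ?B"
    using pair_finite_verts by (intro card_mono) auto
  also have "\<dots> \<le> Suc (card (pverts H - {x}))"
    using pair_finite_verts by (subst card_insert_disjoint) (auto intro: card_image_le)
  also have "\<dots> = card (pverts H)"
    using assms(2) pair_finite_verts by (simp add: card_Suc_Diff1 del: card_Diff_insert)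
  finally show ?thesis .
qed

text \<open>With all copies of \<open>H\<close> prescribed, only the copy of \<open>G\<close> can
  vary, and there the uniqueness of the extension of \<open>C\<^sub>0\<close> decides.\<close>

lemma sudoku_coloring_corona:
  assumes "pair_graph G" and "pair_graph H" and card: "card (pverts H) < chromatic_number G"
    and S: "S \<subseteq> pverts G" and sudoku: "sudoku_coloring G S C\<^sub>0"
  shows "\<exists>D\<^sub>0. sudoku_coloring (corona G H) (Inl ` S \<union> Inr ` (pverts G \<times> pverts H)) D\<^sub>0"
proof -
  let ?k = "chromatic_number G" and ?T = "Inl ` S \<union> Inr ` (pverts G \<times> pverts H)"
  have k: "chromatic_number (corona G H) = ?k"
    using assms(1,2) card by (rule chromatic_number_corona)
  have T: "?T \<subseteq> verts (corona G H)"
    using S by (auto simp: corona_def)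
  obtain c where c: "c \<in> proper_colorings G ?k" "restrict c S = C\<^sub>0"
    and unique: "\<And>d. d \<in> proper_colorings G ?k \<Longrightarrow> restrict d S = C\<^sub>0 \<Longrightarrow> d = c"
    by (rule sudoku_coloringE[OF sudoku]) blast
  obtain d where d: "d \<in> proper_colorings (corona G H) ?k"
    and d_Inl: "\<And>v. v \<in> pverts G \<Longrightarrow> d (Inl v) = c v"
    using extend_coloring_to_corona[OF assms(1,2) c(1) card] by blast
  have "e = d" if e: "e \<in> proper_colorings (corona G H) ?k" and eT: "restrict e ?T = restrict d ?T" for e
  proof -
    have eq: "e z = d z" if "z \<in> ?T" for z
      using fun_cong[OF eT, of z] that by simp
    \<comment> \<open>The projection of \<open>e\<close> to \<open>G\<close> is a proper coloring
      that agrees with \<open>c\<close> on \<open>S\<close>, so it must be \<open>c\<close>.\<close>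
    have "restrict (\<lambda>v\<in>pverts G. e (Inl v)) S = restrict c S"
      using S d_Inl eq by (auto simp: fun_eq_iff restrict_def)
    then have "(\<lambda>v\<in>pverts G. e (Inl v)) = c"
      using c(2) by (intro unique corona_coloring_base[OF e assms(1)]) simp
    then have e_Inl: "e (Inl v) = c v" if "v \<in> pverts G" for v
      using that by (metis restrict_apply')
    \<comment> \<open>Both are \<open>undefined\<close> off the vertices, so agreement on vertices
      gives equality of functions.\<close>
    have ext: "e \<in> extensional (pverts (corona G H))" "d \<in> extensional (pverts (corona G H))"
      using e d by (auto simp: proper_colorings_def PiE_iff)
    show ?thesis
      using ext
    proof (rule extensionalityI)
      fix z assume "z \<in> pverts (corona G H)"
      then show "e z = d z"
        using e_Inl d_Inl eq by (auto simp: corona_def)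
    qed
  qed
  then have "sudoku_coloring (corona G H) ?T (restrict d ?T)"
    using d restrict_in_proper_colorings[OF d T]
    unfolding sudoku_coloring_def extends_coloring_def k by blast
  then show ?thesis
    by blast
qed

theorem theorem2p1:
  fixes G :: "'a pair_pre_digraph" and H :: "'b pair_pre_digraph" and n m :: nat
  assumes "pair_graph G" and "connected G"
    and "pair_graph H" and "connected H"
    and "n = card (pverts G)" and "m = card (pverts H)"
    and "chromatic_number G \<ge> 3"
    and "m \<le> chromatic_number G - 2"
  shows "n * m \<le> sudoku_number (corona G H) \<and>
         sudoku_number (corona G H) \<le> n * m + sudoku_number G"
proof
  interpret G: pair_graph G by (fact assms(1))
  interpret H: pair_graph H by (fact assms(3))
  interpret C: pair_graph "corona G H" by (rule pair_graph_corona) (fact assms)+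
  let ?R = "Inr ` (pverts G \<times> pverts H) :: ('a + 'a \<times> 'b) set"
  \<comment> \<open>The lower bound on the chromatic number rules out truncation in the subtraction
    on \<open>nat\<close>.\<close>
  have m: "card (pverts H) + 2 \<le> chromatic_number G"
    using assms(6-8) by simp
  have k: "chromatic_number (corona G H) = chromatic_number G"
    using assms(1,3) m by (intro chromatic_number_corona) auto
  have R: "card ?R = n * m"
    using assms(5,6) by (simp add: card_image card_cartesian_product)
  show "n * m \<le> sudoku_number (corona G H)"
  proof -
    obtain S C\<^sub>0 where S: "S \<subseteq> pverts (corona G H)" "card S = sudoku_number (corona G H)"
      and sudoku: "sudoku_coloring (corona G H) S C\<^sub>0"
      by (rule C.ex_minimum_sudoku_coloring)
    \<comment> \<open>Copy vertices have degree at most \<open>m\<close>, at most \<chi> - 2, so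
      every Sudoku domain contains all \<open>n * m\<close> of them.\<close>
    have "Inr (v, x) \<in> S" if "v \<in> pverts G" "x \<in> pverts H" for v x
    proof (rule C.low_degree_vertex_in_sudoku_domain[OF sudoku])
      show "Inr (v, x) \<in> pverts (corona G H)"
        using that by (auto simp: corona_def)
      show "card {u. (Inr (v, x), u) \<in> parcs (corona G H)} + 2 \<le> chromatic_number (corona G H)"
        using card_neighbors_copy[OF assms(3) that(2), of v G] m k by linarith
    qed
    then have "?R \<subseteq> S"
      by auto
    then have "card ?R \<le> card S"
      using S(1) C.pair_finite_verts by (intro card_mono) (auto intro: finite_subset)
    then show ?thesis
      using R S(2) by simp
  qed
  show "sudoku_number (corona G H) \<le> n * m + sudoku_number G"
  proof -
    obtain S C\<^sub>0 where S: "S \<subseteq> pverts G" "card S = sudoku_number G"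
      and sudoku: "sudoku_coloring G S C\<^sub>0"
      by (rule G.ex_minimum_sudoku_coloring)
    \<comment> \<open>A minimum Sudoku domain of \<open>G\<close> joined with all the copies is a
      Sudoku domain of the corona; counting it gives the upper bound.\<close>
    obtain D\<^sub>0 where "sudoku_coloring (corona G H) (Inl ` S \<union> ?R) D\<^sub>0"
      using sudoku_coloring_corona[OF assms(1,3) _ S(1) sudoku] m by auto
    then have "sudoku_number (corona G H) \<le> card (Inl ` S \<union> ?R)"
      using S(1) by (intro sudoku_number_le) (auto simp: corona_def)
    also have "\<dots> \<le> card (Inl ` S :: ('a + 'a \<times> 'b) set) + card ?R"
      by (rule card_Un_le)
    also have "\<dots> = n * m + sudoku_number G"
      using R S(2) by (simp add: card_image)
    finally show ?thesis .
  qed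
qed

end
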